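(* For $n\ge2$, $p_n(\Sigma_2)=C(n,2)=L_2(n)$, where $L_2(n)=\frac1n\sum_{d\mid n}\mu(d)2^{n/d}$ and $\mu$ is the Möbius function.
   Context: For $\sigma\in\{+,-\}^k$ ($k\ge2$), let $\mathcal W_k$ be the set of infinite words over $\{0,\dots,k-1\}$ with the linear order $\prec_\sigma$: for $s\neq t$, with $j$ the first index where $s_j\neq t_j$ and $c=|\{i<j:\sigma_{s_i}=-\}|$, $s\prec_\sigma t$ iff ($c$ even and $s_j<t_j$) or ($c$ odd and $s_j>t_j$). The signed shift $\Sigma_\sigma$ deletes the first letter of a word. Let $\mathcal W_{k,n}$ be the set of words $(s_1\dots s_n)^\infty$ with $s_1\dots s_n$ primitive (not a power of a shorter word). For $s\in\mathcal W_{k,n}$ let $\Pi_\sigma(s)\in\mathcal S_n$ be the permutation with $\Pi_\sigma(s)_i<\Pi_\sigma(s)_j$ iff $s_is_{i+1}\dots\prec_\sigma s_js_{j+1}\dots$. Let $\mathcal P_n(\Sigma_\sigma)=\{\Pi_\sigma(s):s\in\mathcal W_{k,n}\}$ and $p_n(\Sigma_\sigma)=|\mathcal P_n(\Sigma_\sigma)|/n$ (the number of classes of $\mathcal P_n(\Sigma_\sigma)$ under cyclic rotation). $\Sigma_k$ denotes the $k$-shift $\Sigma_{+^k}$ (all signs $+$; then $\prec_\sigma$ is lexicographic order). $C(n,i)$ denotes the number of cyclic permutations ($n$-cycles) in $\mathcal S_n$ with exactly $i-1$ descents, a descent of $\tau$ being an $i\in[n-1]$ with $\tau_i>\tau_{i+1}$.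 *)

theory Defs
  imports
    Complex_Main
    "HOL-Library.Stream"
    "HOL-Combinatorics.Orbits"
    "HOL-Computational_Algebra.Squarefree"
begin

datatype sign = Plus | Minus

text \<open>
  A sign vector in $\{+,-\}^k$ is a list \<open>\<sigma>\<close> of length $k$, and an infinite word over
  $\{0,\dots,k-1\}$ is an element of \<open>streams {..<k}\<close>. Stream and list positions start at 0,
  so the letter $s_i$ is \<open>s !! (i - 1)\<close>, while $\sigma_a$ is \<open>\<sigma> ! a\<close>.
  The signed shift is \<open>stl\<close>, and $s_i s_{i+1}\dots$ is \<open>sdrop (i - 1) s\<close>.
\<close>

definition signed_less :: "sign list \<Rightarrow> nat stream \<Rightarrow> nat stream \<Rightarrow> bool" where
  "signed_less \<sigma> s t \<longleftrightarrow>
     (\<exists>j. (\<forall>i<j. s !! i = t !! i) \<and> s !! j \<noteq> t !! j \<and>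
          (let c = card {i. i < j \<and> \<sigma> ! (s !! i) = Minus}
           in (even c \<and> s !! j < t !! j) \<or> (odd c \<and> s !! j > t !! j)))"

definition primitive :: "'a list \<Rightarrow> bool" where
  "primitive u \<longleftrightarrow>
     u \<noteq> [] \<and> \<not> (\<exists>v m. length v < length u \<and> u = concat (replicate m v))"

definition periodic_words :: "nat \<Rightarrow> nat \<Rightarrow> nat stream set" where
  "periodic_words k n = {cycle u | u. length u = n \<and> set u \<subseteq> {..<k} \<and> primitive u}"

text \<open>Permutations in $\mathcal S_n$ are functions fixing everything outside \<open>{1..n}\<close>.\<close>

definition pattern :: "sign list \<Rightarrow> nat \<Rightarrow> nat stream \<Rightarrow> (nat \<Rightarrow> nat)" where
  "pattern \<sigma> n s =
     (THE \<pi>. \<pi> permutes {1..n} \<and>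
        (\<forall>i\<in>{1..n}. \<forall>j\<in>{1..n}.
           \<pi> i < \<pi> j \<longleftrightarrow> signed_less \<sigma> (sdrop (i - 1) s) (sdrop (j - 1) s)))"

definition periodic_patterns :: "sign list \<Rightarrow> nat \<Rightarrow> (nat \<Rightarrow> nat) set" where
  "periodic_patterns \<sigma> n = pattern \<sigma> n ` periodic_words (length \<sigma>) n"

definition num_periodic_patterns :: "sign list \<Rightarrow> nat \<Rightarrow> real" where
  "num_periodic_patterns \<sigma> n = real (card (periodic_patterns \<sigma> n)) / real n"

definition k_shift :: "nat \<Rightarrow> sign list" where
  "k_shift k = replicate k Plus"

definition descents :: "nat \<Rightarrow> (nat \<Rightarrow> nat) \<Rightarrow> nat set" where
  "descents n \<tau> = {i \<in> {1..n - 1}. \<tau> i > \<tau> (i + 1)}"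

text \<open>Writing the condition as \<open>card \<dots> + 1 = i\<close> avoids truncated subtraction at \<open>i = 0\<close>.\<close>

definition num_cyclic_perms :: "nat \<Rightarrow> nat \<Rightarrow> nat" where
  "num_cyclic_perms n i =
     card {\<tau>. \<tau> permutes {1..n} \<and> cyclic_on \<tau> {1..n} \<and> card (descents n \<tau>) + 1 = i}"

definition moebius_mu :: "nat \<Rightarrow> int" where
  "moebius_mu n = (if squarefree n then (- 1) ^ card (prime_factors n) else 0)"

definition necklace_count :: "nat \<Rightarrow> nat \<Rightarrow> real" where
  "necklace_count k n =
     1 / real n * (\<Sum>d | d dvd n. of_int (moebius_mu d) * real k ^ (n div d))"

end

theory Submission
  imports Defs
begin

text \<open>
  Let \<open>X\<close> be the set of pairs of an \<open>n\<close>-cycle \<open>\<tau>\<close> with exactly one descent \<open>d\<close> and a starting point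
  \<open>x \<in> {1..n}\<close>. The itinerary of \<open>(\<tau>, x)\<close> records, for each point of the orbit of \<open>x\<close>, whether it lies
  in \<open>{1..d}\<close> (letter 0) or in \<open>{d+1..n}\<close> (letter 1). As \<open>\<tau>\<close> is increasing on both blocks, comparing
  shifts of the itinerary lexicographically amounts to comparing orbit points, so the pattern of the
  itinerary is the orbit \<open>i \<mapsto> \<tau>\<^bsup>i-1\<^esup> x\<close>, which determines \<open>(\<tau>, x)\<close>. Conversely, in a primitive word
  the map sending the rank of each shift to the rank of the next shift is an \<open>n\<close>-cycle that can descend
  only where the first letter changes from 0 to 1. Hence primitive words, their patterns and \<open>X\<close> are all
  equinumerous, and Moebius inversion counts the primitive words.
\<close>

section \<open>Periodic words\<close>

lemma stream_eqI:
  assumes "\<And>i. s !! i = t !! i"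
  shows "s = t"
  using assms smap_alt[of id s t] by (simp add: stream.map_id)

lemma sdrop_mod_period:
  assumes "sdrop n s = s"
  shows "sdrop (i mod n) s = sdrop i s"
proof -
  have mult: "sdrop (m * n) s = s" for m
    by (induction m) (use assms in \<open>simp_all flip: sdrop_add\<close>)
  have "sdrop i s = sdrop (i mod n) (sdrop (i div n * n) s)"
    by (simp only: sdrop_add div_mult_mod_eq)
  then show ?thesis by (simp add: mult)
qed

lemma snth_mod_period:
  assumes "sdrop n s = s"
  shows "s !! (i mod n) = s !! i"
  using sdrop_mod_period[OF assms, of i] by (metis sdrop_simps(1))

lemma cycle_stake_period:
  assumes "sdrop n s = s" "n > 0"
  shows "cycle (stake n s) = s"
proof -
  let ?u = "stake n s"
  have u: "?u \<noteq> []" "length ?u = n" using assms(2) by auto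
  have per: "sdrop n (cycle ?u) = cycle ?u" using sdrop_cycle_eq[OF u(1)] u(2) by simp
  have st: "stake n (cycle ?u) = ?u" using stake_cycle_eq[OF u(1)] u(2) by simp
  have "cycle ?u !! i = s !! i" for i
  proof -
    have "i mod n < n" using assms(2) by simp
    then have "cycle ?u !! (i mod n) = s !! (i mod n)" using st by (metis stake_nth)
    then show ?thesis using snth_mod_period[OF per] snth_mod_period[OF assms(1)] by metis
  qed
  then show ?thesis by (rule stream_eqI)
qed

section \<open>Least periods and primitive words\<close>

definition least_period :: "'a stream \<Rightarrow> nat" where
  "least_period s = (LEAST d. d > 0 \<and> sdrop d s = s)"

text \<open>The remainder of a period modulo the least period is again a shift fixing
  \<open>s\<close>; being smaller than the least period, it must be 0.\<close>

lemma least_period_dvd_iff: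
  assumes "sdrop n s = s" "n > 0"
  shows "least_period s > 0 \<and> (\<forall>m. sdrop m s = s \<longleftrightarrow> least_period s dvd m)"
proof -
  let ?p = "least_period s"
  have p: "?p > 0 \<and> sdrop ?p s = s"
    unfolding least_period_def by (rule LeastI[of _ n]) (use assms in auto)
  have "sdrop m s = s \<longleftrightarrow> ?p dvd m" for m
  proof
    assume m: "sdrop m s = s"
    have eq: "sdrop (m mod ?p) s = s" using sdrop_mod_period[of ?p s m] p m by simp
    have lt: "m mod ?p < ?p" using p by simp
    have "\<not> (m mod ?p > 0 \<and> sdrop (m mod ?p) s = s)"
      using not_less_Least[OF lt[unfolded least_period_def]] by (simp add: least_period_def)
    with eq show "?p dvd m" by auto
  next
    assume "?p dvd m"
    then have "m mod ?p = 0" by simp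
    then show "sdrop m s = s" using sdrop_mod_period[of ?p s m] p by simp
  qed
  with p show ?thesis by auto
qed

text \<open>The least period of \<open>cycle u\<close> divides \<open>length u\<close>; if it is
  smaller, \<open>u\<close> is a power of its prefix of that length. Conversely, \<open>u\<close>
  being a power of a shorter \<open>v\<close> makes \<open>length v\<close> a period.\<close>

lemma primitive_iff_least_period:
  assumes "u \<noteq> []"
  shows "primitive u \<longleftrightarrow> least_period (cycle u) = length u"
proof -
  let ?s = "cycle u" and ?p = "least_period (cycle u)"
  have lp: "?p > 0" "\<And>m. sdrop m ?s = ?s \<longleftrightarrow> ?p dvd m"
    using least_period_dvd_iff[of "length u" ?s] assms by auto
  have pd: "?p dvd length u" using lp(2)[of "length u"] assms by simp
  show ?thesis
  proof
    assume prim: "primitive u"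
    show "?p = length u"
    proof (rule ccontr)
      assume "?p \<noteq> length u"
      then have less: "?p < length u" using pd assms by (simp add: dvd_imp_le nat_less_le)
      let ?v = "stake ?p ?s"
      have v: "?v \<noteq> []" "length ?v = ?p" using lp(1) by auto
      have "cycle ?v = ?s" by (rule cycle_stake_period) (use lp in auto)
      then have "u = stake (length u) (cycle ?v)" using assms by simp
      also have "\<dots> = concat (replicate (length u div ?p) ?v)"
        using stake_cycle_eq_mod_0[of ?v "length u"] v pd by simp
      finally show False using prim less v unfolding primitive_def by metis
    qed
  next
    assume eq: "?p = length u"
    show "primitive u" unfolding primitive_def
    proof (rule conjI[OF assms], rule notI)
      assume "\<exists>v m. length v < length u \<and> u = concat (replicate m v)"
      then obtain v m where vm: "length v < length u" "u = concat (replicate m v)" by auto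
      have v: "v \<noteq> []" using vm assms by auto
      have len: "length u = m * length v" using vm(2) by (simp add: length_concat sum_list_replicate)
      have "stake (length u) (cycle v) = u"
        using stake_cycle_eq_mod_0[OF v, of "length u"] vm v len by simp
      moreover have "sdrop (length u) (cycle v) = cycle v"
        using sdrop_cycle_eq_mod_0[OF v, of "length u"] len by simp
      ultimately have "?s = cycle v"
        using cycle_stake_period[of "length u" "cycle v"] assms by simp
      then have "?p dvd length v" using lp(2)[of "length v"] v by simp
      then show False using vm(1) v eq by (auto dest: dvd_imp_le)
    qed
  qed
qed

text \<open>Trades finite words for conditions on the stream itself. Periodicity is listed
  separately because \<open>least_period\<close> is unspecified on streams without a positive
  period.\<close>

lemma periodic_words_altdef:
  assumes "n > 0"
  shows "periodic_words k n =
    {s \<in> streams {..<k}. sdrop n s = s \<and> least_period s = n}"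
proof (intro set_eqI iffI)
  fix s assume "s \<in> periodic_words k n"
  then obtain u where u: "s = cycle u" "length u = n" "set u \<subseteq> {..<k}" "primitive u"
    unfolding periodic_words_def by auto
  then have "u \<noteq> []" using assms by auto
  then show "s \<in> {s \<in> streams {..<k}. sdrop n s = s \<and> least_period s = n}"
    using u primitive_iff_least_period[of u] sdrop_cycle_eq[of u] by (auto simp: streams_iff_sset)
next
  fix s assume "s \<in> {s \<in> streams {..<k}. sdrop n s = s \<and> least_period s = n}"
  then have s: "sset s \<subseteq> {..<k}" "sdrop n s = s" "least_period s = n"
    by (auto simp: streams_iff_sset)
  let ?u = "stake n s"
  have u: "?u \<noteq> []" "cycle ?u = s" using assms cycle_stake_period[OF s(2) assms] by auto
  then have "primitive ?u" "set ?u \<subseteq> {..<k}"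
    using primitive_iff_least_period[of ?u] sset_cycle[of ?u] s by auto
  then show "s \<in> periodic_words k n"
    unfolding periodic_words_def using u by (force intro: exI[of _ ?u])
qed

lemma periodic_wordsI:
  assumes "s \<in> streams {..<k}" "sdrop n s = s" "n > 0"
    "\<And>m. 0 < m \<Longrightarrow> m < n \<Longrightarrow> sdrop m s \<noteq> s"
  shows "s \<in> periodic_words k n"
proof -
  have lp: "least_period s > 0" "sdrop (least_period s) s = s" "least_period s dvd n"
    using least_period_dvd_iff[OF assms(2,3)] assms(2) by auto
  then have "least_period s = n"
    using assms(3,4) by (metis dvd_imp_le le_neq_implies_less)
  then show ?thesis using assms periodic_words_altdef by auto
qed

lemma periodic_words_sdrop_eq_iff:
  assumes "s \<in> periodic_words k n" "n > 0"
  shows "sdrop i s = sdrop j s \<longleftrightarrow> i mod n = j mod n"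
proof -
  have s: "sdrop n s = s" "\<And>m. sdrop m s = s \<longleftrightarrow> n dvd m"
    using assms least_period_dvd_iff[of n s] by (auto simp: periodic_words_altdef)
  have *: "i mod n \<ge> j mod n" if eq: "sdrop i s = sdrop j s" for i j
  proof (rule ccontr)
    let ?i = "i mod n" and ?j = "j mod n"
    assume lt: "\<not> ?i \<ge> ?j"
    have "?i < n" "?j < n" using assms(2) by auto
    have "sdrop ?i s = sdrop ?j s" using eq sdrop_mod_period[OF s(1)] by metis
    \<comment> \<open>Completing the left side to a full period turns the equality into a period
      \<open>?j - ?i\<close>, which lies strictly between 0 and \<open>n\<close>.\<close>
    then have "sdrop (n - ?i) (sdrop ?i s) = sdrop (n - ?i) (sdrop ?j s)" by simp
    moreover have "?i + (n - ?i) = n" "?j + (n - ?i) = n + (?j - ?i)"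
      using \<open>?i < n\<close> lt by auto
    ultimately have "sdrop (n + (?j - ?i)) s = s" using s(1) by simp
    then have "n dvd ?j - ?i" using s(2) by simp
    then show False using \<open>?j < n\<close> lt by (auto dest!: dvd_imp_le)
  qed
  show ?thesis
    using *[of i j] *[of j i] sdrop_mod_period[OF s(1)] by (metis le_antisym)
qed

section \<open>Counting periodic words by least period\<close>

lemma bij_betw_stake_period:
  assumes "n > 0"
  shows "bij_betw (stake n) {s \<in> streams A. sdrop n s = s} {u. set u \<subseteq> A \<and> length u = n}"
proof (rule bij_betw_byWitness[where f' = cycle])
  show "\<forall>s\<in>{s \<in> streams A. sdrop n s = s}. cycle (stake n s) = s"
    using cycle_stake_period assms by auto
  show "\<forall>u\<in>{u. set u \<subseteq> A \<and> length u = n}. stake n (cycle u) = u"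
    using assms stake_cycle_eq by fastforce
  have "set (stake n s) \<subseteq> sset s" for s :: "'a stream"
    by (metis stake_sdrop sset_shift Un_upper1)
  then show "stake n ` {s \<in> streams A. sdrop n s = s} \<subseteq> {u. set u \<subseteq> A \<and> length u = n}"
    by (fastforce simp: streams_iff_sset)
  show "cycle ` {u. set u \<subseteq> A \<and> length u = n} \<subseteq> {s \<in> streams A. sdrop n s = s}"
    using assms sdrop_cycle_eq by (fastforce simp: streams_iff_sset)
qed

lemma finite_periodic_words:
  assumes "n > 0"
  shows "finite (periodic_words k n)"
proof -
  have "finite {s \<in> streams {..<k}. sdrop n s = s}"
    using bij_betw_finite[OF bij_betw_stake_period[OF assms, of "{..<k}"]]
      finite_lists_length_eq[of "{..<k}" n] by simp
  then show ?thesis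
    by (rule rev_finite_subset) (auto simp: periodic_words_altdef[OF assms])
qed

text \<open>The \<open>k ^ n\<close> words fixed by the \<open>n\<close>-th shift split according to
  their least period, which runs over the divisors of \<open>n\<close>.\<close>

lemma sum_card_periodic_words:
  assumes "n > 0"
  shows "(\<Sum>d | d dvd n. card (periodic_words k d)) = k ^ n"
proof -
  have pos: "d > 0" if "d dvd n" for d using that assms by (rule dvd_pos_nat[rotated])
  have "{s \<in> streams {..<k}. sdrop n s = s} = (\<Union>d\<in>{d. d dvd n}. periodic_words k d)"
  proof (intro set_eqI iffI)
    fix s assume s: "s \<in> {s \<in> streams {..<k}. sdrop n s = s}"
    then have lp: "least_period s > 0" "\<And>m. sdrop m s = s \<longleftrightarrow> least_period s dvd m"
      using least_period_dvd_iff[of n s] assms by auto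
    then show "s \<in> (\<Union>d\<in>{d. d dvd n}. periodic_words k d)"
      using s by (intro UN_I[of "least_period s"]) (auto simp: periodic_words_altdef)
  next
    fix s assume "s \<in> (\<Union>d\<in>{d. d dvd n}. periodic_words k d)"
    then obtain d where d: "d dvd n" "s \<in> periodic_words k d" by auto
    then have "s \<in> streams {..<k}" "sdrop d s = s" "n mod d = 0"
      using pos by (auto simp: periodic_words_altdef)
    then show "s \<in> {s \<in> streams {..<k}. sdrop n s = s}"
      using sdrop_mod_period[of d s n] by simp
  qed
  moreover have "card (\<Union>d\<in>{d. d dvd n}. periodic_words k d) =
      (\<Sum>d | d dvd n. card (periodic_words k d))"
  proof (rule card_UN_disjoint)
    show "finite {d. d dvd n}" using assms by simp
    show "\<forall>d\<in>{d. d dvd n}. finite (periodic_words k d)"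
      using pos finite_periodic_words by blast
    show "\<forall>d\<in>{d. d dvd n}. \<forall>e\<in>{d. d dvd n}. d \<noteq> e \<longrightarrow>
        periodic_words k d \<inter> periodic_words k e = {}"
      using pos by (auto simp: periodic_words_altdef)
  qed
  moreover have "card {s \<in> streams {..<k}. sdrop n s = s} = k ^ n"
    using bij_betw_same_card[OF bij_betw_stake_period[OF assms, of "{..<k}"]]
      card_lists_length_eq[of "{..<k}" n] by simp
  ultimately show ?thesis by simp
qed

section \<open>Moebius inversion\<close>

lemma moebius_mu_prime_mult:
  assumes "prime p" "\<not> p dvd d"
  shows "moebius_mu (p * d) = - moebius_mu d"
proof -
  have cop: "coprime p d" using assms prime_imp_coprime by blast
  have sq: "squarefree (p * d) \<longleftrightarrow> squarefree d"
    using squarefree_mult_coprime[OF cop] squarefree_prime[OF assms(1)] squarefree_multD(2) by blast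
  have nz: "p \<noteq> 0" "d \<noteq> 0" using assms by (auto intro: ccontr)
  have "prime_factors (p * d) = insert p (prime_factors d)" "p \<notin> prime_factors d"
    using nz assms by (auto simp: prime_factors_product prime_factorization_prime)
  then have "card (prime_factors (p * d)) = Suc (card (prime_factors d))" by simp
  then show ?thesis by (simp add: moebius_mu_def sq)
qed

lemma moebius_mu_eq_0:
  assumes "prime p" "p * p dvd d"
  shows "moebius_mu d = 0"
proof -
  have "\<not> squarefree d"
    using assms by (intro not_squarefreeI[of p]) (auto simp: power2_eq_square)
  then show ?thesis by (simp add: moebius_mu_def)
qed

lemma sum_moebius_mu_divisors:
  assumes "n > 0"
  shows "(\<Sum>d | d dvd n. moebius_mu d) = (if n = 1 then 1 else 0)"
proof (cases "n = 1")
  case True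
  then show ?thesis by (simp add: moebius_mu_def)
next
  case False
  then obtain p where p: "prime p" "p dvd n" using prime_factor_nat by blast
  have p0: "p > 0" using p(1) prime_gt_0_nat by blast
  let ?A = "{d. d dvd n \<and> \<not> p dvd d}"
  let ?B = "{d. d dvd n \<and> p dvd d \<and> \<not> p * p dvd d}"
  have fin: "finite {d. d dvd n}" using assms by simp
  \<comment> \<open>Multiplication by \<open>p\<close> pairs the divisors prime to \<open>p\<close> with those divisible by \<open>p\<close> exactly once.\<close>
  have B: "?B = (*) p ` ?A"
  proof (intro set_eqI iffI)
    fix d assume "d \<in> ?B"
    then obtain e where "d = p * e" "d dvd n" "\<not> p * p dvd d" by auto
    then show "d \<in> (*) p ` ?A" using p0 by (auto dest: dvd_mult_right)
  next
    fix d assume "d \<in> (*) p ` ?A"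
    then obtain e where e: "d = p * e" "e dvd n" "\<not> p dvd e" by auto
    have "coprime p e" using e(3) p(1) prime_imp_coprime by blast
    then have "p * e dvd n" using p(2) e(2) by (rule divides_mult[rotated 2])
    then show "d \<in> ?B" using e p0 by auto
  qed
  \<comment> \<open>The divisors left out are those divisible by \<open>p * p\<close>, where the
    Moebius function vanishes.\<close>
  have "(\<Sum>d | d dvd n. moebius_mu d) = (\<Sum>d\<in>?A \<union> ?B. moebius_mu d)"
    using fin by (intro sum.mono_neutral_right) (auto intro: moebius_mu_eq_0[OF p(1)])
  also have "\<dots> = (\<Sum>d\<in>?A. moebius_mu d) + (\<Sum>d\<in>?B. moebius_mu d)"
    using fin by (intro sum.union_disjoint) auto
  also have "(\<Sum>d\<in>?B. moebius_mu d) = (\<Sum>d\<in>?A. moebius_mu (p * d))"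
    unfolding B using p0 by (subst sum.reindex) (auto simp: inj_on_def)
  also have "\<dots> = - (\<Sum>d\<in>?A. moebius_mu d)"
    using moebius_mu_prime_mult[OF p(1)] by (simp add: sum_negf)
  finally show ?thesis using False by simp
qed

text \<open>After exchanging the two sums, the coefficient of \<open>g e\<close> is the sum of the
  Moebius function over the divisors of \<open>n div e\<close>, which is 0 unless
  \<open>e = n\<close>.\<close>

lemma moebius_inversion:
  fixes f g :: "nat \<Rightarrow> real"
  assumes "n > 0" and f: "\<And>m. m > 0 \<Longrightarrow> f m = (\<Sum>d | d dvd m. g d)"
  shows "(\<Sum>d | d dvd n. of_int (moebius_mu d) * f (n div d)) = g n"
proof -
  have fin: "finite {d. d dvd n}" using assms by simp
  have mult: "d dvd n \<and> e dvd n div d \<longleftrightarrow> d * e dvd n" for d e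
    by (metis dvd_div_iff_mult dvd_mult_left dvd_mult_right dvd_0_left mult.commute assms(1) less_not_refl)
  have iff: "d dvd n \<and> e dvd n div d \<longleftrightarrow> e dvd n \<and> d dvd n div e" for d e
    unfolding mult by (simp add: mult.commute)
  \<comment> \<open>Writes the inner range as a restriction of a fixed set, the shape that
    \<open>sum.swap_restrict\<close> needs.\<close>
  have sub: "{e. e dvd n div d} = {e. e \<in> {e. e dvd n} \<and> e dvd n div d}" if "d dvd n" for d
    using iff[of d] that by auto
  have "(\<Sum>d | d dvd n. of_int (moebius_mu d) * f (n div d)) =
     (\<Sum>d | d dvd n. \<Sum>e | e dvd n div d. of_int (moebius_mu d) * g e)"
    using assms(1) by (intro sum.cong) (auto simp: sum_distrib_left f dvd_div_eq_0_iff)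
  also have "\<dots> = (\<Sum>d | d dvd n. \<Sum>e | e \<in> {e. e dvd n} \<and> e dvd n div d. of_int (moebius_mu d) * g e)"
    using sub by (intro sum.cong) auto
  also have "\<dots> = (\<Sum>e | e dvd n. \<Sum>d | d \<in> {d. d dvd n} \<and> e dvd n div d. of_int (moebius_mu d) * g e)"
    by (rule sum.swap_restrict[OF fin fin])
  also have "\<dots> = (\<Sum>e | e dvd n. of_int (\<Sum>d | d dvd n div e. moebius_mu d) * g e)"
    by (intro sum.cong refl) (auto simp: sum_distrib_right iff intro!: sum.cong)
  also have "\<dots> = (\<Sum>e | e dvd n. if e = n then g e else 0)"
  proof (intro sum.cong refl)
    fix e assume "e \<in> {e. e dvd n}"
    then have "n div e > 0" "n div e = 1 \<longleftrightarrow> e = n"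
      using assms(1) by (auto simp: dvd_div_eq_0_iff elim!: dvdE)
    then show "of_int (\<Sum>d | d dvd n div e. moebius_mu d) * g e = (if e = n then g e else 0)"
      by (simp only: sum_moebius_mu_divisors) simp
  qed
  also have "\<dots> = g n" using fin by simp
  finally show ?thesis .
qed

lemma card_periodic_words:
  assumes "n > 0"
  shows "real (card (periodic_words k n)) = real n * necklace_count k n"
proof -
  have "(\<Sum>d | d dvd n. of_int (moebius_mu d) * real k ^ (n div d)) = real (card (periodic_words k n))"
    by (rule moebius_inversion[OF assms])
      (metis of_nat_power of_nat_sum sum_card_periodic_words)
  then show ?thesis using assms by (simp add: necklace_count_def)
qed

section \<open>Lexicographic order and patterns\<close>

definition lex_less :: "nat stream \<Rightarrow> nat stream \<Rightarrow> bool" where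
  "lex_less s t \<longleftrightarrow> (\<exists>j. (\<forall>i<j. s !! i = t !! i) \<and> s !! j < t !! j)"

text \<open>Letters below \<open>k\<close> keep the lookup in the sign list in range, so no
  \<open>Minus\<close> is ever met and the parity is always even.\<close>

lemma signed_less_k_shift:
  assumes "s \<in> streams {..<k}"
  shows "signed_less (k_shift k) s t \<longleftrightarrow> lex_less s t"
proof -
  have "{i. i < j \<and> k_shift k ! (s !! i) = Minus} = {}" for j
    using assms by (auto simp: k_shift_def streams_iff_snth)
  then have "signed_less (k_shift k) s t \<longleftrightarrow>
      (\<exists>j. (\<forall>i<j. s !! i = t !! i) \<and> s !! j \<noteq> t !! j \<and> s !! j < t !! j)"
    by (simp only: signed_less_def Let_def) simp
  then show ?thesis by (auto simp: lex_less_def)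
qed

lemma lex_less_irrefl: "\<not> lex_less s s"
  by (simp add: lex_less_def)

lemma lex_less_trans:
  assumes "lex_less s t" "lex_less t u"
  shows "lex_less s u"
proof -
  obtain i j where i: "\<forall>l<i. s !! l = t !! l" "s !! i < t !! i"
    and j: "\<forall>l<j. t !! l = u !! l" "t !! j < u !! j"
    using assms by (auto simp: lex_less_def)
  \<comment> \<open>The first difference between \<open>s\<close> and \<open>u\<close> is the
    earlier of the two given differences.\<close>
  then have "\<forall>l<min i j. s !! l = u !! l" "s !! min i j < u !! min i j"
    by (auto simp: min_def) (metis less_trans linorder_neqE_nat not_le)+
  then show ?thesis unfolding lex_less_def by blast
qed

lemma lex_less_linear:
  assumes "s \<noteq> t"
  shows "lex_less s t \<or> lex_less t s"
proof -
  have "\<exists>j. s !! j \<noteq> t !! j" using assms stream_eqI by blast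
  then obtain j where "s !! j \<noteq> t !! j" "\<forall>i<j. s !! i = t !! i"
    using exists_least_iff[of "\<lambda>j. s !! j \<noteq> t !! j"] by auto
  then show ?thesis by (metis lex_less_def linorder_neqE_nat)
qed

lemma lex_less_shd_le: "lex_less s t \<Longrightarrow> shd s \<le> shd t"
  unfolding lex_less_def by (metis gr0I less_imp_le order_refl snth.simps(1))

lemma lex_less_stl:
  assumes "lex_less s t" "shd s = shd t"
  shows "lex_less (stl s) (stl t)"
proof -
  obtain j where j: "\<forall>i<j. s !! i = t !! i" "s !! j < t !! j"
    using assms(1) by (auto simp: lex_less_def)
  with assms(2) obtain m where "j = Suc m" by (cases j) auto
  with j have "\<forall>i<m. stl s !! i = stl t !! i" "stl s !! m < stl t !! m" by auto
  then show ?thesis by (auto simp: lex_less_def)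
qed

section \<open>Permutations determined by a ranking\<close>

lemma permutes_eq_Suc_card_less:
  assumes "\<pi> permutes {1..n}" "i \<in> {1..n}"
  shows "\<pi> i = Suc (card {j \<in> {1..n}. \<pi> j < \<pi> i})"
proof -
  have im: "\<pi> ` {1..n} = {1..n}" using assms(1) by (rule permutes_image)
  then have le: "\<pi> i \<in> {1..n}" using assms(2) by blast
  have "\<pi> ` {j \<in> {1..n}. \<pi> j < \<pi> i} = {z \<in> \<pi> ` {1..n}. z < \<pi> i}" by auto
  also have "\<dots> = {1..<\<pi> i}" unfolding im using le by auto
  finally have "card {j \<in> {1..n}. \<pi> j < \<pi> i} = card {1..<\<pi> i}"
    by (metis card_image assms(1) permutes_inj_on)
  then show ?thesis using le by simp
qed

text \<open>Makes the definite description usable: a permutation is determined by the order of its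
  values, since each value is one more than the number of smaller ones.\<close>

lemma pattern_eqI:
  assumes "\<pi> permutes {1..n}"
    and "\<And>i j. i \<in> {1..n} \<Longrightarrow> j \<in> {1..n} \<Longrightarrow>
      \<pi> i < \<pi> j \<longleftrightarrow> signed_less \<sigma> (sdrop (i - 1) s) (sdrop (j - 1) s)"
  shows "pattern \<sigma> n s = \<pi>"
  unfolding pattern_def
proof (rule the_equality)
  fix \<rho> assume \<rho>: "\<rho> permutes {1..n} \<and> (\<forall>i\<in>{1..n}. \<forall>j\<in>{1..n}.
    \<rho> i < \<rho> j \<longleftrightarrow> signed_less \<sigma> (sdrop (i - 1) s) (sdrop (j - 1) s))"
  show "\<rho> = \<pi>"
  proof
    fix i
    show "\<rho> i = \<pi> i"
    proof (cases "i \<in> {1..n}")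
      case True
      then have "{j \<in> {1..n}. \<rho> j < \<rho> i} = {j \<in> {1..n}. \<pi> j < \<pi> i}"
        using \<rho> assms(2) by auto
      then show ?thesis
        using permutes_eq_Suc_card_less[OF _ True] \<rho> assms(1) by metis
    next
      case False
      then show ?thesis using \<rho> assms(1) by (auto simp: permutes_not_in)
    qed
  qed
qed (use assms in blast)

text \<open>Sends each index to one more than the number of indices below it in
  \<open>r\<close>.\<close>

lemma ex_rank_permutation:
  fixes r :: "nat \<Rightarrow> nat \<Rightarrow> bool"
  assumes irrefl: "\<And>i. \<not> r i i" and trans: "\<And>i j l. r i j \<Longrightarrow> r j l \<Longrightarrow> r i l"
    and lin: "\<And>i j. i \<in> {1..n} \<Longrightarrow> j \<in> {1..n} \<Longrightarrow> i \<noteq> j \<Longrightarrow> r i j \<or> r j i"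
  obtains \<pi> where "\<pi> permutes {1..n}" "\<And>i j. i \<in> {1..n} \<Longrightarrow> j \<in> {1..n} \<Longrightarrow> \<pi> i < \<pi> j \<longleftrightarrow> r i j"
proof
  define \<pi> where "\<pi> = (\<lambda>i. if i \<in> {1..n} then Suc (card {j \<in> {1..n}. r j i}) else i)"
  have less: "\<pi> i < \<pi> j" if "i \<in> {1..n}" "j \<in> {1..n}" "r i j" for i j
  proof -
    have "{l \<in> {1..n}. r l i} \<subset> {l \<in> {1..n}. r l j}"
      using that irrefl trans by blast
    then show ?thesis using that by (simp add: \<pi>_def psubset_card_mono)
  qed
  show iff: "\<pi> i < \<pi> j \<longleftrightarrow> r i j" if "i \<in> {1..n}" "j \<in> {1..n}" for i j
    using that less lin by (metis less_irrefl less_not_sym)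
  have inj: "inj_on \<pi> {1..n}"
    by (rule inj_onI) (metis less lin less_irrefl)
  have "\<pi> i \<in> {1..n}" if "i \<in> {1..n}" for i
  proof -
    have "{j \<in> {1..n}. r j i} \<subset> {1..n}" using that irrefl by blast
    then have "card {j \<in> {1..n}. r j i} < n" using psubset_card_mono[of "{1..n}"] by simp
    then show ?thesis using that by (simp add: \<pi>_def)
  qed
  then have "\<pi> ` {1..n} = {1..n}" using inj by (intro endo_inj_surj) auto
  with inj show "\<pi> permutes {1..n}"
    by (intro bij_imp_permutes) (auto simp: bij_betw_def \<pi>_def)
qed

lemma ex_periodic_pattern:
  assumes "s \<in> periodic_words k n" "n > 0"
  obtains \<pi> where "\<pi> permutes {1..n}"
    "\<And>i j. i \<in> {1..n} \<Longrightarrow> j \<in> {1..n} \<Longrightarrow> \<pi> i < \<pi> j \<longleftrightarrow> lex_less (sdrop (i - 1) s) (sdrop (j - 1) s)"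
proof (rule ex_rank_permutation[where n = n and r = "\<lambda>i j. lex_less (sdrop (i - 1) s) (sdrop (j - 1) s)"])
  fix i j assume ij: "i \<in> {1..n}" "j \<in> {1..n}" "i \<noteq> j"
  then have "(i - 1) mod n \<noteq> (j - 1) mod n" by auto
  then have "sdrop (i - 1) s \<noteq> sdrop (j - 1) s"
    using periodic_words_sdrop_eq_iff[OF assms] by blast
  then show "lex_less (sdrop (i - 1) s) (sdrop (j - 1) s) \<or> lex_less (sdrop (j - 1) s) (sdrop (i - 1) s)"
    by (rule lex_less_linear)
qed (use that in \<open>auto intro: lex_less_irrefl[THEN notE] lex_less_trans\<close>)

section \<open>Itineraries of cycles with one descent\<close>

lemma less_if_increasing_steps:
  fixes f :: "nat \<Rightarrow> nat"
  assumes step: "\<And>i. a \<le> i \<Longrightarrow> i < b \<Longrightarrow> f i < f (Suc i)" and "a \<le> i" "i < j" "j \<le> b"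
  shows "f i < f j"
  using \<open>i < j\<close> \<open>j \<le> b\<close>
proof (induction j)
  case (Suc j)
  have "f j < f (Suc j)" using Suc.prems \<open>a \<le> i\<close> by (intro step) auto
  then show ?case using Suc by (cases "i = j") auto
qed simp

lemma ascent_if_not_descent:
  assumes "\<tau> permutes S" "z \<notin> descents n \<tau>" "1 \<le> z" "z < n"
  shows "\<tau> z < \<tau> (Suc z)"
proof -
  have "z \<in> {1..n - 1}" using assms(3,4) by auto
  then have "\<tau> z \<le> \<tau> (Suc z)" using assms(2) by (simp add: descents_def)
  moreover have "\<tau> z \<noteq> \<tau> (Suc z)" by (simp add: inj_eq[OF permutes_inj[OF assms(1)]])
  ultimately show ?thesis by simp
qed

text \<open>The iterates before the first return to \<open>x\<close> are distinct and exhaust the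
  orbit, so the return time is \<open>card S\<close>.\<close>

lemma cyclic_on_funpow_card:
  assumes "cyclic_on f S" "x \<in> S"
  shows "(f ^^ card S) x = x" and "bij_betw (\<lambda>i. (f ^^ i) x) {..<card S} S"
proof -
  have S: "orbit f x = S" using assms by (rule orbit_cyclic_eq3)
  then have x: "x \<in> orbit f x" using assms(2) by simp
  let ?m = "funpow_dist1 f x x"
  have im: "(\<lambda>i. (f ^^ i) x) ` {0..<?m} = S" using orbit_conv_funpow_dist1[OF x] S by simp
  have "?m = card S" using card_image[OF inj_on_funpow_dist1[OF x]] im by simp
  then show "(f ^^ card S) x = x" "bij_betw (\<lambda>i. (f ^^ i) x) {..<card S} S"
    using funpow_dist1_prop[OF x] inj_on_funpow_dist1[OF x] im
    by (auto simp: bij_betw_def atLeast0LessThan)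
qed

text \<open>The form \<open>+ 1 = 2\<close> makes this literally the set counted by
  \<open>num_cyclic_perms n 2\<close>.\<close>

definition one_descent_cycles :: "nat \<Rightarrow> (nat \<Rightarrow> nat) set" where
  "one_descent_cycles n =
    {\<tau>. \<tau> permutes {1..n} \<and> cyclic_on \<tau> {1..n} \<and> card (descents n \<tau>) + 1 = 2}"

text \<open>\<open>the_elem\<close> yields the descent only if it is unique, whence the restriction
  to \<open>one_descent_cycles\<close> in the lemmas below.\<close>

definition itinerary :: "nat \<Rightarrow> (nat \<Rightarrow> nat) \<Rightarrow> nat \<Rightarrow> nat stream" where
  "itinerary n \<tau> x = smap (\<lambda>z. if z \<le> the_elem (descents n \<tau>) then 0 else 1) (siterate \<tau> x)"

definition orbit_perm :: "nat \<Rightarrow> (nat \<Rightarrow> nat) \<Rightarrow> nat \<Rightarrow> nat \<Rightarrow> nat" where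
  "orbit_perm n \<tau> x = (\<lambda>i. if i \<in> {1..n} then (\<tau> ^^ (i - 1)) x else i)"

text \<open>While the letters agree, both points lie on the same side of the descent, where
  \<open>\<tau>\<close> preserves their order. At the first disagreement the smaller point therefore
  has letter 0.\<close>

lemma itinerary_less:
  assumes "\<tau> \<in> one_descent_cycles n" "x \<in> {1..n}" "(\<tau> ^^ i) x < (\<tau> ^^ j) x"
  shows "lex_less (sdrop i (itinerary n \<tau> x)) (sdrop j (itinerary n \<tau> x))"
proof -
  let ?y = "\<lambda>i. (\<tau> ^^ i) x"
  have perm: "\<tau> permutes {1..n}" and cyc: "cyclic_on \<tau> {1..n}" and "card (descents n \<tau>) = 1"
    using assms(1) by (auto simp: one_descent_cycles_def)
  then obtain d where d: "descents n \<tau> = {d}" by (auto simp: card_1_singleton_iff)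
  have y: "?y i \<in> {1..n}" for i using cyclic_on_funpow_in[OF cyc assms(2)] .
  have step: "\<tau> z < \<tau> (Suc z)" if "1 \<le> z" "z < n" "z \<noteq> d" for z
    by (rule ascent_if_not_descent[OF perm _ that(1,2)]) (simp add: d that(3))
  have mono: "\<tau> z < \<tau> w" if "z < w" "z \<in> {1..n}" "w \<in> {1..n}" "z \<le> d \<longleftrightarrow> w \<le> d" for z w
  proof (cases "w \<le> d")
    case True
    show ?thesis
      by (rule less_if_increasing_steps[of 1 w \<tau>], rule step) (use that True in auto)
  next
    case False
    show ?thesis
      by (rule less_if_increasing_steps[of z n \<tau>], rule step) (use that False in auto)
  qed
  let ?P = "\<lambda>m. (?y (i + m) \<le> d) \<noteq> (?y (j + m) \<le> d)"
  have less: "?y (i + m) < ?y (j + m)" if "\<forall>l<m. \<not> ?P l" for m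
    using that
  proof (induction m)
    case 0
    then show ?case using assms(3) by simp
  next
    case (Suc m)
    then have "\<tau> (?y (i + m)) < \<tau> (?y (j + m))" by (intro mono y) auto
    then show ?case by simp
  qed
  have "\<exists>m. ?P m"
  proof (rule ccontr)
    assume no: "\<nexists>m. ?P m"
    \<comment> \<open>Otherwise the orbit of \<open>?y i\<close> would stay strictly below that of \<open>?y j\<close> and could not reach \<open>n\<close>.\<close>
    have "n \<in> orbit \<tau> (?y i)" using orbit_cyclic_eq3[OF cyc y] assms(2) by simp
    then obtain m where "(\<tau> ^^ m) (?y i) = n" by (auto simp: orbit_altdef)
    then have "?y (i + m) = n" by (metis add.commute comp_apply funpow_add)
    then show False using less[of m] no y[of "j + m"] by auto
  qed
  then obtain m where m: "?P m" "\<forall>l<m. \<not> ?P l" using exists_least_iff[of ?P] by auto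
  then have "?y (i + m) \<le> d" "\<not> ?y (j + m) \<le> d" using less[OF m(2)] by linarith+
  then show ?thesis
    using m(2) unfolding lex_less_def itinerary_def
    by (intro exI[of _ m]) (simp add: d sdrop_snth del: sdrop_smap)
qed

lemma itinerary_periodic:
  assumes "\<tau> \<in> one_descent_cycles n" "x \<in> {1..n}"
  shows "itinerary n \<tau> x \<in> periodic_words 2 n"
proof (rule periodic_wordsI)
  have cyc: "cyclic_on \<tau> {1..n}" using assms(1) by (simp add: one_descent_cycles_def)
  note cyc = cyclic_on_funpow_card[OF cyc assms(2), simplified]
  show "itinerary n \<tau> x \<in> streams {..<2}"
    by (simp add: itinerary_def streams_iff_snth)
  show "sdrop n (itinerary n \<tau> x) = itinerary n \<tau> x"
    using cyc(1) by (simp add: itinerary_def)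
  show "n > 0" using assms(2) by simp
  fix m assume m: "0 < m" "m < n"
  then have "(\<tau> ^^ m) x \<noteq> (\<tau> ^^ 0) x"
    using bij_betw_imp_inj_on[OF cyc(2)] by (metis inj_on_eq_iff lessThan_iff less_trans less_irrefl)
  \<comment> \<open>Distinct orbit points are comparable, so the itinerary and its
    \<open>m\<close>-th shift are strictly ordered and cannot coincide.\<close>
  then show "sdrop m (itinerary n \<tau> x) \<noteq> itinerary n \<tau> x"
    using itinerary_less[OF assms, of m 0] itinerary_less[OF assms, of 0 m] lex_less_irrefl
    by (metis linorder_neqE_nat sdrop.simps(1))
qed

lemma orbit_perm_permutes:
  assumes "cyclic_on \<tau> {1..n}" "x \<in> {1..n}"
  shows "orbit_perm n \<tau> x permutes {1..n}"
proof (rule bij_imp_permutes)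
  have "bij_betw (\<lambda>i. i - 1) {1..n} {..<n}"
    by (rule bij_betw_byWitness[where f' = Suc]) auto
  then have "bij_betw ((\<lambda>i. (\<tau> ^^ i) x) \<circ> (\<lambda>i. i - 1)) {1..n} {1..n}"
    using cyclic_on_funpow_card(2)[OF assms] by (intro bij_betw_trans) auto
  then show "bij_betw (orbit_perm n \<tau> x) {1..n} {1..n}"
    by (rule bij_betw_cong[THEN iffD1, rotated]) (simp add: orbit_perm_def)
qed (auto simp: orbit_perm_def)

text \<open>One direction is \<open>itinerary_less\<close>; the other follows because orbit points
  are totally ordered and \<open>lex_less\<close> is a strict order.\<close>

lemma pattern_itinerary:
  assumes "\<tau> \<in> one_descent_cycles n" "x \<in> {1..n}"
  shows "pattern (k_shift 2) n (itinerary n \<tau> x) = orbit_perm n \<tau> x"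
proof (rule pattern_eqI)
  have cyc: "cyclic_on \<tau> {1..n}" using assms(1) by (simp add: one_descent_cycles_def)
  show perm: "orbit_perm n \<tau> x permutes {1..n}" by (rule orbit_perm_permutes[OF cyc assms(2)])
  let ?s = "itinerary n \<tau> x"
  fix i j assume ij: "i \<in> {1..n}" "j \<in> {1..n}"
  have str: "sdrop m ?s \<in> streams {..<2}" for m by (simp add: itinerary_def streams_iff_snth)
  have "orbit_perm n \<tau> x i < orbit_perm n \<tau> x j \<longleftrightarrow> lex_less (sdrop (i - 1) ?s) (sdrop (j - 1) ?s)"
  proof -
    have less: "lex_less (sdrop (i - 1) ?s) (sdrop (j - 1) ?s)"
      if "i \<in> {1..n}" "j \<in> {1..n}" "orbit_perm n \<tau> x i < orbit_perm n \<tau> x j" for i j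
      using itinerary_less[OF assms, of "i - 1" "j - 1"] that by (simp add: orbit_perm_def)
    show ?thesis
    proof
      assume lex: "lex_less (sdrop (i - 1) ?s) (sdrop (j - 1) ?s)"
      show "orbit_perm n \<tau> x i < orbit_perm n \<tau> x j"
      proof (rule ccontr)
        assume "\<not> ?thesis"
        then consider "orbit_perm n \<tau> x j < orbit_perm n \<tau> x i" | "i = j"
          using inj_eq[OF permutes_inj[OF perm], of i j] by linarith
        then show False
          using lex less[OF ij(2,1)] lex_less_irrefl lex_less_trans by cases blast+
      qed
    qed (rule less[OF ij])
  qed
  then show "orbit_perm n \<tau> x i < orbit_perm n \<tau> x j \<longleftrightarrow>
      signed_less (k_shift 2) (sdrop (i - 1) ?s) (sdrop (j - 1) ?s)"
    by (simp add: signed_less_k_shift[OF str])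
qed

text \<open>The first entry of the orbit list is \<open>x\<close>, and \<open>\<tau>\<close> sends
  each entry to the next, cyclically.\<close>

lemma inj_on_orbit_perm:
  "inj_on (\<lambda>(\<tau>, x). orbit_perm n \<tau> x) (one_descent_cycles n \<times> {1..n})"
proof (rule inj_onI, clarify)
  fix \<tau> x \<tau>' x'
  assume \<tau>: "\<tau> \<in> one_descent_cycles n" "\<tau>' \<in> one_descent_cycles n"
    and x: "x \<in> {1..n}" "x' \<in> {1..n}" and eq: "orbit_perm n \<tau> x = orbit_perm n \<tau>' x'"
  have eq': "(\<tau> ^^ i) x = (\<tau>' ^^ i) x'" if "i < n" for i
    using fun_cong[OF eq, of "Suc i"] that by (simp add: orbit_perm_def)
  have xx: "x = x'" using eq'[of 0] x by simp
  have perm: "\<tau> permutes {1..n}" "\<tau>' permutes {1..n}"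
    and cyc: "cyclic_on \<tau> {1..n}" "cyclic_on \<tau>' {1..n}"
    using \<tau> by (auto simp: one_descent_cycles_def)
  \<comment> \<open>Index \<open>n\<close>, where both orbits return to \<open>x\<close>, is
    included to fix the image of the last orbit point.\<close>
  have eq'': "(\<tau> ^^ i) x = (\<tau>' ^^ i) x" if "i \<le> n" for i
    using that eq'[of i] xx cyclic_on_funpow_card(1)[OF cyc(1) x(1)] cyclic_on_funpow_card(1)[OF cyc(2) x(2)]
    by (cases "i = n") auto
  have "\<tau> z = \<tau>' z" for z
  proof (cases "z \<in> {1..n}")
    case True
    then have "z \<in> (\<lambda>i. (\<tau> ^^ i) x) ` {..<n}"
      using bij_betw_imp_surj_on[OF cyclic_on_funpow_card(2)[OF cyc(1) x(1)]] by simp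
    then obtain i where "i < n" "z = (\<tau> ^^ i) x" by auto
    then show ?thesis using eq''[of i] eq''[of "Suc i"] by simp
  next
    case False
    then show ?thesis using perm by (metis permutes_not_in)
  qed
  then show "\<tau> = \<tau>' \<and> x = x'" using xx by auto
qed

text \<open>Shifts with the same first letter are ordered like their successors, and first letters
  grow with rank. So the rank map can descend only at the change from 0 to 1; a cycle on
  \<open>n \<ge> 2\<close> points must descend somewhere.\<close>

lemma periodic_word_eq_itinerary:
  assumes s: "s \<in> periodic_words 2 n" and n: "n \<ge> 2"
  obtains \<tau> x where "\<tau> \<in> one_descent_cycles n" "x \<in> {1..n}" "s = itinerary n \<tau> x"
proof -
  have n0: "n > 0" using n by simp
  have per: "sdrop n s = s" and str: "s \<in> streams {..<2}"
    using s by (auto simp: periodic_words_altdef[OF n0])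
  obtain \<pi> where \<pi>: "\<pi> permutes {1..n}"
    and ord: "\<And>i j. i \<in> {1..n} \<Longrightarrow> j \<in> {1..n} \<Longrightarrow> \<pi> i < \<pi> j \<longleftrightarrow> lex_less (sdrop (i - 1) s) (sdrop (j - 1) s)"
    using ex_periodic_pattern[OF s n0] by blast
  \<comment> \<open>\<open>y i\<close> is the rank of the \<open>i\<close>-th shift of \<open>s\<close>, and \<open>\<tau>\<close> sends each rank to that of the next shift.\<close>
  define y where "y i = \<pi> (Suc (i mod n))" for i
  define \<tau> where "\<tau> z = (if z \<in> {1..n} then y (inv \<pi> z) else z)" for z
  have idx: "Suc (i mod n) \<in> {1..n}" for i using n0 by (simp add: Suc_leI)
  have y_in: "y i \<in> {1..n}" for i
    unfolding y_def using permutes_in_image[OF \<pi>] idx by blast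
  have y_less: "y i < y j \<longleftrightarrow> lex_less (sdrop i s) (sdrop j s)" for i j
    unfolding y_def using ord[OF idx idx, of i j] sdrop_mod_period[OF per] by simp
  have y_eq: "y i = y j \<longleftrightarrow> i mod n = j mod n" for i j
    by (simp add: y_def inj_eq[OF permutes_inj[OF \<pi>]])
  have y_surj: "\<exists>i<n. z = y i" if "z \<in> {1..n}" for z
  proof -
    have "z \<in> \<pi> ` {1..n}" using that permutes_image[OF \<pi>] by simp
    then obtain i where "i \<in> {1..n}" "z = \<pi> i" by auto
    then show ?thesis by (intro exI[of _ "i - 1"]) (auto simp: y_def)
  qed
  have \<tau>_y: "\<tau> (y i) = y (Suc i)" for i
  proof -
    \<comment> \<open>As \<open>\<pi>\<close> counts positions from 1 and \<open>y\<close> counts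
      shifts from 0, \<open>inv \<pi>\<close> already gives the index of the next shift.\<close>
    have "inv \<pi> (y i) = Suc (i mod n)" by (simp add: y_def permutes_inverses(2)[OF \<pi>])
    then have "\<tau> (y i) = y (Suc (i mod n))" using y_in by (simp add: \<tau>_def)
    also have "\<dots> = y (Suc i)" by (simp add: y_eq mod_Suc_eq)
    finally show ?thesis .
  qed
  have pow: "(\<tau> ^^ i) (y 0) = y i" for i
    by (induction i) (simp_all add: \<tau>_y)
  have yn: "y n = y 0" by (simp add: y_eq)
  have orbit: "orbit \<tau> (y 0) = {1..n}"
  proof -
    have "orbit \<tau> (y 0) = {(\<tau> ^^ i) (y 0) | i. i < n}"
      by (rule orbit_altdef_bounded) (use n0 pow yn in auto)
    also have "\<dots> = {y i | i. i < n}" by (simp only: pow)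
    also have "\<dots> = {1..n}" using y_in y_surj by blast
    finally show ?thesis .
  qed
  have cyc: "cyclic_on \<tau> {1..n}"
    using orbit y_in by (intro cyclic_on_singleI[of "y 0"]) auto
  have "{1..n} \<subseteq> \<tau> ` {1..n}"
  proof
    fix z assume "z \<in> {1..n}"
    then obtain i where i: "i < n" "z = y i" using y_surj by blast
    \<comment> \<open>Going back one shift is going forward \<open>n - 1\<close> shifts, which
      avoids a predecessor of 0.\<close>
    have "y i = y (Suc (i + n - 1))" using n0 by (simp add: y_eq)
    then have "z = \<tau> (y (i + n - 1))" using i \<tau>_y by simp
    then show "z \<in> \<tau> ` {1..n}" using y_in by blast
  qed
  moreover have "\<tau> ` {1..n} \<subseteq> {1..n}" using y_in by (auto simp: \<tau>_def)
  ultimately have "\<tau> ` {1..n} = {1..n}" by blast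
  then have "bij_betw \<tau> {1..n} {1..n}"
    by (simp add: bij_betw_def eq_card_imp_inj_on)
  then have perm: "\<tau> permutes {1..n}" by (rule bij_imp_permutes) (auto simp: \<tau>_def)
  have letter_mono: "s !! i \<le> s !! j" if "y i \<le> y j" for i j
  proof (cases "y i = y j")
    case True
    then show ?thesis using snth_mod_period[OF per] y_eq by (metis order_refl)
  next
    case False
    then have "lex_less (sdrop i s) (sdrop j s)" using that y_less[of i j] by linarith
    then show ?thesis using lex_less_shd_le[of "sdrop i s" "sdrop j s"] by simp
  qed
  have \<tau>_mono: "y (Suc i) < y (Suc j)" if "y i < y j" "s !! i = s !! j" for i j
    using that lex_less_stl[of "sdrop i s" "sdrop j s"] by (simp add: y_less)
  \<comment> \<open>At a descent the conclusion of \<open>\<tau>_mono\<close> fails, so the letters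
    differ; monotonicity and the bound 2 leave only 0 followed by 1.\<close>
  have descent_letters: "s !! i = 0 \<and> s !! j = 1"
    if "d \<in> descents n \<tau>" "y i = d" "y j = Suc d" for d i j
  proof -
    have "\<tau> d > \<tau> (Suc d)" using that(1) by (simp add: descents_def)
    then have "\<not> y (Suc i) < y (Suc j)" using \<tau>_y[of i] \<tau>_y[of j] that by simp
    then have "s !! i \<noteq> s !! j" using \<tau>_mono[of i j] that by auto
    moreover have "s !! i \<le> s !! j" using letter_mono that by simp
    moreover have "s !! j < 2" using str by (auto simp: streams_iff_snth)
    ultimately show ?thesis by linarith
  qed
  have "descents n \<tau> \<noteq> {}"
  proof
    assume none: "descents n \<tau> = {}"
    have step: "\<tau> z < \<tau> (Suc z)" if "1 \<le> z" "z < n" for z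
      by (rule ascent_if_not_descent[OF perm _ that]) (simp add: none)
    have mono: "y (Suc i) < y (Suc j)" if "y i < y j" for i j
      using less_if_increasing_steps[of 1 n \<tau>, OF step _ that] y_in by (simp add: \<tau>_y)
    \<comment> \<open>An increasing map moves \<open>y 0\<close> monotonically, so its orbit cannot return.\<close>
    have "y 0 \<noteq> y 1" using n by (simp add: y_eq)
    then consider "y 0 < y 1" | "y 1 < y 0" by linarith
    then show False
    proof cases
      case 1
      then have "y i < y (Suc i)" for i by (induction i) (simp_all add: mono)
      then have "y 0 < y n" using n0 by (rule lift_Suc_mono_less)
      then show False using yn by simp
    next
      case 2
      then have "y (Suc i) < y i" for i by (induction i) (simp_all add: mono)
      \<comment> \<open>The lifting lemma is weak, so the chain starts at index 1 and strictness
        comes from \<open>y 1 < y 0\<close>.\<close>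
      then have "y n \<le> y 1" using n0 by (intro lift_Suc_antimono_le[of y 1 n]) (auto intro: less_imp_le)
      then have "y n < y 0" using 2 by simp
      then show False using yn by simp
    qed
  qed
  then obtain d where d: "d \<in> descents n \<tau>" by blast
  then have d_in: "d \<in> {1..n}" "Suc d \<in> {1..n}" by (auto simp: descents_def)
  then obtain i j where ij: "y i = d" "y j = Suc d" using y_surj by metis
  note letters_d = descent_letters[OF d ij]
  \<comment> \<open>Rank \<open>d\<close> carries 0 and rank \<open>d + 1\<close> carries 1;
    monotonicity of letters settles all other ranks.\<close>
  have letter: "s !! m = (if y m \<le> d then 0 else 1)" for m
  proof (cases "y m \<le> d")
    case True
    then show ?thesis using letter_mono[of m i] ij letters_d by simp
  next
    case False
    then have "s !! j \<le> s !! m" using letter_mono ij by simp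
    moreover have "s !! m < 2" using str by (auto simp: streams_iff_snth)
    ultimately show ?thesis using False letters_d by auto
  qed
  have uniq: "descents n \<tau> = {d}"
  proof -
    have "e = d" if e: "e \<in> descents n \<tau>" for e
    proof -
      have "e \<in> {1..n}" "Suc e \<in> {1..n}" using e by (auto simp: descents_def)
      then obtain i' j' where ij': "y i' = e" "y j' = Suc e" using y_surj by metis
      \<comment> \<open>By \<open>letter\<close>, rank \<open>e\<close> with letter 0 is at most
        \<open>d\<close>, and rank \<open>e + 1\<close> with letter 1 exceeds it.\<close>
      then have "e \<le> d" "\<not> Suc e \<le> d"
        using descent_letters[OF e ij'] letter by (metis zero_neq_one)+
      then show ?thesis by simp
    qed
    then show ?thesis using d by blast
  qed
  show ?thesis
  proof (rule that[of \<tau> "y 0"])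
    show "\<tau> \<in> one_descent_cycles n" using perm cyc uniq by (simp add: one_descent_cycles_def)
    show "y 0 \<in> {1..n}" by (rule y_in)
    have "s !! m = itinerary n \<tau> (y 0) !! m" for m
      by (simp add: itinerary_def uniq pow letter)
    then show "s = itinerary n \<tau> (y 0)" by (rule stream_eqI)
  qed
qed

section \<open>Equal counts of words, patterns and pointed cycles\<close>

theorem theorem3p7:
  fixes n :: nat
  assumes "n \<ge> 2"
  shows "num_periodic_patterns (k_shift 2) n = real (num_cyclic_perms n 2)
       \<and> real (num_cyclic_perms n 2) = necklace_count 2 n"
proof -
  let ?X = "one_descent_cycles n \<times> {1..n}"
  let ?I = "\<lambda>(\<tau>, x). itinerary n \<tau> x" and ?G = "\<lambda>(\<tau>, x). orbit_perm n \<tau> x"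
  let ?p = "pattern (k_shift 2) n"
  have words: "periodic_words 2 n = ?I ` ?X"
  proof
    show "periodic_words 2 n \<subseteq> ?I ` ?X"
    proof
      fix s assume "s \<in> periodic_words 2 n"
      then obtain \<tau> x where "\<tau> \<in> one_descent_cycles n" "x \<in> {1..n}" "s = itinerary n \<tau> x"
        using assms by (rule periodic_word_eq_itinerary)
      then show "s \<in> ?I ` ?X" by force
    qed
  qed (auto intro: itinerary_periodic)
  have pG: "?p (?I a) = ?G a" if "a \<in> ?X" for a using that pattern_itinerary by auto
  \<comment> \<open>By \<open>pG\<close>, the injective map \<open>?G\<close> factors through
    \<open>?I\<close>.\<close>
  have "inj_on ?I ?X"
    using inj_on_orbit_perm[of n] pG by (metis (no_types, lifting) inj_on_def)
  then have card_words: "card (periodic_words 2 n) = card ?X"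
    unfolding words by (rule card_image)
  have "periodic_patterns (k_shift 2) n = ?p ` ?I ` ?X"
    unfolding periodic_patterns_def using words by (simp add: k_shift_def)
  also have "\<dots> = ?G ` ?X" using pG by (simp add: image_image cong: image_cong)
  finally have card_patterns: "card (periodic_patterns (k_shift 2) n) = card ?X"
    using card_image[OF inj_on_orbit_perm] by simp
  \<comment> \<open>The \<open>n\<close> starting points of each cycle give the factor that cancels
    the division by \<open>n\<close> in both \<open>num_periodic_patterns\<close> and
    \<open>necklace_count\<close>.\<close>
  have card_X: "card ?X = num_cyclic_perms n 2 * n"
    by (simp add: card_cartesian_product num_cyclic_perms_def one_descent_cycles_def)
  show ?thesis
    using card_periodic_words[of n 2] card_words card_patterns card_X assms
    by (simp add: num_periodic_patterns_def)
qed

end
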